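(* Let $n\ge 1$, let $I_n=\{\sigma\in S_n:\sigma^2=\mathrm{id}\}$, and let $$\mathcal{I}_n^{d}(t)=\sum_{\sigma\in I_n}t^{d(\sigma)}.$$ For all integers $k$ with $1\le k\le 0.175\,n^{0.931}$, $$[t^{k-1}]\mathcal{I}_n^{d}(t)<[t^{k}]\mathcal{I}_n^{d}(t)\qquad\text{and}\qquad [t^{n-1-k}]\mathcal{I}_n^{d}(t)>[t^{n-k}]\mathcal{I}_n^{d}(t).$$
   Context: $S_n$ is the symmetric group on $\{1,\dots,n\}$, with $\sigma_i=\sigma(i)$. The number of descents is $d(\sigma)=|\{i:1\le i<n,\ \sigma_i>\sigma_{i+1}\}|$. $[t^i]P(t)$ denotes the coefficient of $t^i$ in $P(t)$. *)

theory Defs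
  imports Complex_Main "HOL-Combinatorics.Permutations"
    "HOL-Computational_Algebra.Polynomial"
begin

text \<open>
  The symmetric group on \<open>{1..n}\<close> is the set of all \<open>s\<close> with \<open>s permutes {1..n}\<close>;
  such an \<open>s\<close> is the identity outside \<open>{1..n}\<close>, so that \<open>s \<circ> s = id\<close> says exactly
  that \<open>s\<close> squares to the identity in this group.
\<close>

definition involutions :: "nat \<Rightarrow> (nat \<Rightarrow> nat) set" where
  "involutions n = {s. s permutes {1..n} \<and> s \<circ> s = id}"

definition descents :: "nat \<Rightarrow> (nat \<Rightarrow> nat) \<Rightarrow> nat" where
  "descents n s = card {i. 1 \<le> i \<and> i < n \<and> s i > s (i + 1)}"

definition inv_descent_poly :: "nat \<Rightarrow> int poly" where
  "inv_descent_poly n = (\<Sum>s\<in>involutions n. monom 1 (descents n s))"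

end

theory Submission
  imports Defs "HOL-Library.Multiset" "HOL-Library.Product_Lexorder" "HOL-Library.FuncSet"
begin

text \<open>
  Write \<open>I n k\<close> for the number of involutions in \<open>S\<^sub>n\<close> with \<open>k\<close> descents.  The sequence \<open>I n 0, I n 1,
  \<dots>, I n (n - 1)\<close> is palindromic and increases strictly up to its middle, and the bound on \<open>k\<close> in
  the theorem implies \<open>2 * k < n\<close>.  The argument for unimodality is that of Guo and Zeng; it rests
  on a recurrence of order two in \<open>n\<close>.

  The recurrence comes from symmetric matrices.  Let \<open>N m n\<close> be the number of symmetric \<open>m\<close> by \<open>m\<close>
  matrices over the natural numbers whose entries add up to \<open>n\<close>.  Such a matrix arises in exactly
  one way from an involution \<open>s\<close> in \<open>S\<^sub>n\<close> and a division of \<open>{1..n}\<close> into \<open>m\<close> consecutive blocks,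
  possibly empty, on each of which \<open>s\<close> increases: count the \<open>i\<close> in block \<open>a\<close> for which \<open>s i\<close> lies in
  block \<open>b\<close>.  An involution with \<open>k\<close> descents admits \<open>(n + m - 1 - k) choose n\<close> such divisions, so
  \<open>N m n = (\<Sum>k. I n k * ((n + m - 1 - k) choose n))\<close> (\<open>card_sym_msets_eq_inv_count\<close>).

  Double counting yields \<open>n * N m n = m * N m (n - 1) + (m\<^sup>2 + n - 2) * N m (n - 2)\<close>
  (\<open>card_sym_msets_rec\<close>).  Two binomial identities translate this into the recurrence
  \<open>inv_count_rec\<close> for \<open>I n k\<close>; the translation is possible because the expansion of \<open>N m n\<close>
  determines its coefficients, the system of equations being unitriangular.

  The recurrence for \<open>I n k\<close> is symmetric under reflection of \<open>k\<close>, which gives the palindromic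
  property (\<open>inv_count_symmetric\<close>).  Subtracting consecutive instances gives a recurrence for the
  differences \<open>I n k - I n (k - 1)\<close> whose coefficients are nonnegative up to the middle, apart from
  boundary cases, and strict growth follows by induction (\<open>inv_diff_pos\<close>).
\<close>

section \<open>Counting symmetric multisets of pairs\<close>

text \<open>
  A multiset of pairs that is invariant under swapping is a symmetric matrix with entries in the
  natural numbers: the multiplicity of \<open>(i, j)\<close> is the entry at \<open>(i, j)\<close>, and the size is the sum
  of all entries.
\<close>

definition sym_msets :: "nat \<Rightarrow> nat \<Rightarrow> (nat \<times> nat) multiset set" where
  "sym_msets m n = {M. size M = n \<and> set_mset M \<subseteq> {..<m} \<times> {..<m} \<and> image_mset prod.swap M = M}"

lemma finite_sym_msets [simp]: "finite (sym_msets m n)"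
proof (rule finite_subset)
  show "sym_msets m n \<subseteq> multisets_of_size ({..<m} \<times> {..<m}) n"
    by (auto simp: sym_msets_def multisets_of_size_def)
qed auto

lemma sum_count_sym_msets:
  assumes "M \<in> sym_msets m n"
  shows "(\<Sum>x\<in>{..<m} \<times> {..<m}. count M x) = n"
proof -
  have "n = (\<Sum>x\<in>set_mset M. count M x)"
    using assms by (simp add: sym_msets_def size_multiset_overloaded_eq)
  also have "\<dots> = (\<Sum>x\<in>{..<m} \<times> {..<m}. count M x)"
    using assms by (intro sum.mono_neutral_left) (auto simp: sym_msets_def count_eq_zero_iff)
  finally show ?thesis by simp
qed

lemma count_swap_sym_msets:
  assumes "M \<in> sym_msets m n"
  shows "count M (prod.swap x) = count M x"
proof -
  have "count (image_mset prod.swap M) (prod.swap x) = count M x"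
    by (cases x, induction M) auto
  then show ?thesis using assms by (simp add: sym_msets_def)
qed

text \<open>
  Removing \<open>K\<close> is a bijection from the symmetric multisets of size \<open>n + r\<close> that contain \<open>x\<close>
  to those of size \<open>n\<close>, and it lowers the multiplicity of \<open>x\<close> by one.  It is used with \<open>K = {#x#}\<close> for \<open>x\<close> on the diagonal
  and with \<open>K = {#x, prod.swap x#}\<close> off the diagonal, the smallest symmetric multisets that
  contain \<open>x\<close>.
\<close>

lemma sum_count_shift:
  assumes K: "K \<in> sym_msets m r" "count K x = 1"
    and sub: "\<And>M. M \<in> sym_msets m (n + r) \<Longrightarrow> x \<in># M \<Longrightarrow> K \<subseteq># M"
  shows "(\<Sum>M\<in>sym_msets m (n + r). count M x)
       = (\<Sum>M\<in>sym_msets m n. count M x) + card (sym_msets m n)"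
proof -
  have "(\<Sum>M\<in>sym_msets m (n + r). count M x)
      = (\<Sum>M\<in>{M \<in> sym_msets m (n + r). x \<in># M}. count M x)"
    by (intro sum.mono_neutral_right) (auto simp: count_eq_zero_iff)
  also have "\<dots> = (\<Sum>M\<in>sym_msets m n. count M x + 1)"
  proof (rule sum.reindex_bij_witness[where i = "\<lambda>M. M + K" and j = "\<lambda>M. M - K"])
    fix M assume M: "M \<in> {M \<in> sym_msets m (n + r). x \<in># M}"
    then have sub': "K \<subseteq># M" using sub by blast
    then show "M - K + K = M" by simp
    show "M - K \<in> sym_msets m n"
    proof -
      have "set_mset (M - K) \<subseteq> {..<m} \<times> {..<m}"
        using M set_mset_mono[OF diff_subset_eq_self[of M K]] unfolding sym_msets_def by blast
      with M K sub' show ?thesis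
        by (simp add: sym_msets_def size_Diff_submset image_mset_Diff)
    qed
    show "count (M - K) x + 1 = count M x"
      using K M by (auto simp: Suc_le_eq)
  next
    fix M assume M: "M \<in> sym_msets m n"
    show "M + K - K = M" by simp
    have "x \<in># K" using K by (simp flip: count_greater_zero_iff)
    with M K show "M + K \<in> {M \<in> sym_msets m (n + r). x \<in># M}"
      by (auto simp: sym_msets_def)
  qed
  also have "\<dots> = (\<Sum>M\<in>sym_msets m n. count M x) + card (sym_msets m n)"
    by (simp only: sum.distrib card_eq_sum)
  finally show ?thesis .
qed

text \<open>
  This is the recurrence for the coefficients of \<open>(1 - u)\<close> to the power \<open>-m\<close> times
  \<open>(1 - u\<^sup>2)\<close> to the power \<open>-m(m-1)/2\<close>, obtained by double counting.  Summing the multiplicities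
  of all pairs over all multisets of size \<open>k\<close> gives \<open>k\<close> times their number.  On the other hand
  the total multiplicity \<open>P x (n + 2)\<close> of one pair reduces to \<open>P x n\<close>: by two steps of length one
  on the diagonal, by one step of length two elsewhere.
\<close>

lemma card_sym_msets_rec:
  "(n + 2) * card (sym_msets m (n + 2))
    = m * card (sym_msets m (n + 1)) + (m\<^sup>2 + n) * card (sym_msets m n)"
proof -
  define c where "c k = card (sym_msets m k)" for k
  define P where "P x k = (\<Sum>M\<in>sym_msets m k. count M x)" for x k
  define Q where "Q = {..<m} \<times> {..<m}"
  define \<Delta> where "\<Delta> = (\<lambda>i. (i, i)) ` {..<m}"
  have fin: "finite Q" and sub: "\<Delta> \<subseteq> Q" by (auto simp: Q_def \<Delta>_def)
  have card\<Delta>: "card \<Delta> = m" by (simp add: \<Delta>_def card_image inj_on_def)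
  have cardQ: "card (Q - \<Delta>) = m\<^sup>2 - m"
    using sub card\<Delta> by (subst card_Diff_subset) (auto simp: \<Delta>_def Q_def power2_eq_square)
  have total: "(\<Sum>x\<in>Q. P x k) = k * c k" for k
  proof -
    have "(\<Sum>x\<in>Q. P x k) = (\<Sum>M\<in>sym_msets m k. \<Sum>x\<in>Q. count M x)"
      unfolding P_def by (rule sum.swap)
    also have "\<dots> = k * c k" by (simp add: Q_def sum_count_sym_msets c_def)
    finally show ?thesis .
  qed
  have diag: "P x (k + 1) = P x k + c k" if "x \<in> \<Delta>" for x k
    unfolding P_def c_def using that
    by (intro sum_count_shift[of "{#x#}"]) (auto simp: sym_msets_def \<Delta>_def)
  have diag2: "P x (n + 2) = P x n + c n + c (n + 1)" if "x \<in> \<Delta>" for x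
    using diag[OF that, of n] diag[OF that, of "n + 1"] by simp
  have off: "P x (n + 2) = P x n + c n" if "x \<in> Q - \<Delta>" for x
    unfolding P_def c_def
  proof (rule sum_count_shift[of "{#x, prod.swap x#}"])
    have ne: "prod.swap x \<noteq> x" using that by (auto simp: \<Delta>_def Q_def prod_eq_iff)
    then show "count {#x, prod.swap x#} x = 1" by simp
    show "{#x, prod.swap x#} \<in> sym_msets m 2"
      using that by (auto simp: sym_msets_def Q_def)
    fix M assume M: "M \<in> sym_msets m (n + 2)" "x \<in># M"
    have "prod.swap x \<in># M"
      using M count_swap_sym_msets[OF M(1), of x] by (metis count_eq_zero_iff)
    with M ne show "{#x, prod.swap x#} \<subseteq># M"
      by (cases x) (auto simp: insert_subset_eq_iff in_diff_count)
  qed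
  have "(n + 2) * c (n + 2) = (\<Sum>x\<in>Q - \<Delta>. P x (n + 2)) + (\<Sum>x\<in>\<Delta>. P x (n + 2))"
    using sum.subset_diff[OF sub fin, of "\<lambda>x. P x (n + 2)"] by (simp add: total)
  also have "\<dots> = (\<Sum>x\<in>Q - \<Delta>. P x n) + (\<Sum>x\<in>\<Delta>. P x n)
      + (m\<^sup>2 - m) * c n + m * (c n + c (n + 1))"
    by (simp add: off diag2 sum.distrib card\<Delta> cardQ algebra_simps del: add_2_eq_Suc')
  also have "(\<Sum>x\<in>Q - \<Delta>. P x n) + (\<Sum>x\<in>\<Delta>. P x n) = n * c n"
    using sum.subset_diff[OF sub fin, of "\<lambda>x. P x n"] by (simp add: total)
  also have "n * c n + (m\<^sup>2 - m) * c n + m * (c n + c (n + 1))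
      = m * c (n + 1) + ((m\<^sup>2 - m) + m + n) * c n"
    by (simp add: algebra_simps)
  also have "(m\<^sup>2 - m) + m = m\<^sup>2"
    by (cases m) (simp_all add: power2_eq_square)
  finally show ?thesis unfolding c_def .
qed

section \<open>Weakly increasing words with prescribed strict steps\<close>

text \<open>
  When \<open>D\<close> is the descent set of a permutation \<open>s\<close>, the condition on \<open>w\<close> says that the pairs
  \<open>(w i, s i)\<close> increase lexicographically.  Words are extensional functions, so that equal words
  are equal functions.
\<close>

definition lex_words :: "nat \<Rightarrow> nat \<Rightarrow> nat set \<Rightarrow> (nat \<Rightarrow> nat) set" where
  "lex_words n m D = {w \<in> {1..n} \<rightarrow>\<^sub>E {..<m}.
     \<forall>i. 1 \<le> i \<and> i < n \<longrightarrow> w i \<le> w (i + 1) \<and> (i \<in> D \<longrightarrow> w i < w (i + 1))}"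

lemma finite_lex_words [simp]: "finite (lex_words n m D)"
proof -
  have "finite ({1..n} \<rightarrow>\<^sub>E {..<m})" by (intro finite_PiE) auto
  then show ?thesis unfolding lex_words_def by simp
qed

lemma lex_words_mono: 
  assumes "w \<in> lex_words n m D" "1 \<le> i" "i \<le> j" "j \<le> n"
  shows "w i \<le> w j"
  using assms(3,1,2,4)
proof (induction j rule: dec_induct)
  case (step k)
  then have "w k \<le> w (k + 1)" by (auto simp: lex_words_def)
  with step show ?case by auto
qed simp

text \<open>
  Classification by the last letter: either it is below the largest admissible letter \<open>m\<close>, or it
  is \<open>m\<close> and the rest is a word over the letters up to \<open>m\<close>, without \<open>m\<close> itself if the last step
  has to be strict.
\<close>

lemma lex_words_Suc_Suc:
  fixes n m D
  defines "m' \<equiv> if n \<in> D then m else Suc m"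
  assumes "n = 0 \<Longrightarrow> n \<notin> D"
  shows "lex_words (Suc n) (Suc m) D
    = lex_words (Suc n) m D \<union> (\<lambda>w. w(Suc n := m)) ` lex_words n m' D" (is "?L = ?A \<union> ?B")
proof (intro equalityI subsetI)
  fix w assume w: "w \<in> ?L"
  show "w \<in> ?A \<union> ?B"
  proof (cases "w (Suc n) = m")
    case False
    have "w (Suc n) < Suc m" using w by (simp add: lex_words_def PiE_iff)
    then have wl: "w (Suc n) < m" using False by simp
    have "w i < m" if "i \<in> {1..Suc n}" for i
      using lex_words_mono[OF w, of i "Suc n"] that wl by auto
    then have "w \<in> ?A" using w by (auto simp: lex_words_def PiE_iff)
    then show ?thesis ..
  next
    case True
    have "w i < m'" if "i \<in> {1..n}" for i
    proof -
      have "w i \<le> w n" using lex_words_mono[OF w, of i n] that by auto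
      moreover have "w n \<le> w (n + 1) \<and> (n \<in> D \<longrightarrow> w n < w (n + 1))"
        using w that by (simp add: lex_words_def)
      then have "w n < m'" using True by (auto simp: m'_def)
      ultimately show ?thesis by simp
    qed
    then have "w(Suc n := undefined) \<in> lex_words n m' D"
      using w by (auto simp: lex_words_def PiE_iff extensional_def)
    moreover have "w = (w(Suc n := undefined))(Suc n := m)" using True by auto
    ultimately show ?thesis by blast
  qed
next
  fix w assume "w \<in> ?A \<union> ?B"
  then show "w \<in> ?L"
  proof
    assume "w \<in> ?A"
    then show ?thesis by (simp add: lex_words_def PiE_iff less_SucI)
  next
    assume "w \<in> ?B"
    then obtain u where u: "u \<in> lex_words n m' D" "w = u(Suc n := m)" by blast
    have lt: "u i < m'" if "i \<in> {1..n}" for i using u that by (auto simp: lex_words_def PiE_iff)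
    have "w i < Suc m" if "i \<in> {1..Suc n}" for i
      using lt[of i] that u(2) by (auto simp: m'_def split: if_splits)
    moreover have "w i \<le> w (i + 1) \<and> (i \<in> D \<longrightarrow> w i < w (i + 1))" if "1 \<le> i" "i < Suc n" for i
      using lt[of i] that u by (cases "i = n") (auto simp: m'_def lex_words_def split: if_splits)
    moreover have "w \<in> extensional {1..Suc n}"
      using u by (auto simp: extensional_def lex_words_def PiE_iff)
    ultimately show ?thesis by (auto simp: lex_words_def PiE_iff)
  qed
qed

text \<open>
  The classification by the last letter turns into the rule of Pascal.  Equivalently, adding to
  every \<open>w i\<close> the number of non-strict steps before \<open>i\<close> makes the word strictly increasing, that is,
  a set of \<open>n\<close> letters among \<open>n + m - 1 - card (D \<inter> {1..<n})\<close>.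
\<close>

lemma card_lex_words:
  "card (lex_words n m D) = (n + m - 1 - card (D \<inter> {1..<n})) choose n"
proof (induction n arbitrary: m)
  case 0
  have "lex_words 0 m D = {\<lambda>_. undefined}" by (auto simp: lex_words_def)
  then show ?case by simp
next
  case (Suc n)
  note IH = Suc
  define D' where "D' = D \<inter> {1..<Suc n}"
  have D'_n: "card D' \<le> n"
    using card_mono[of "{1..<Suc n}" D'] by (auto simp: D'_def)
  have step: "card (lex_words (Suc n) (Suc m) D)
      = card (lex_words (Suc n) m D) + ((n + m - card D') choose n)" for m
  proof -
    define m' where "m' = (if n \<in> D' then m else Suc m)"
    have D: "n \<in> D' \<longleftrightarrow> n \<in> D - {0}" by (auto simp: D'_def)
    have words: "lex_words n m D = lex_words n m (D - {0})" for n m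
      by (auto simp: lex_words_def)
    have eq: "lex_words (Suc n) (Suc m) D
        = lex_words (Suc n) m D \<union> (\<lambda>w. w(Suc n := m)) ` lex_words n m' D"
      using lex_words_Suc_Suc[of n "D - {0}" m] unfolding m'_def D words[symmetric] by simp
    have dj: "lex_words (Suc n) m D \<inter> (\<lambda>w. w(Suc n := m)) ` lex_words n m' D = {}"
    proof -
      have "w (Suc n) < m" if "w \<in> lex_words (Suc n) m D" for w
        using that by (simp add: lex_words_def PiE_iff)
      then show ?thesis by fastforce
    qed
    have inj: "inj_on (\<lambda>w. w(Suc n := m)) (lex_words n m' D)"
    proof (rule inj_onI)
      fix u v assume uv: "u \<in> lex_words n m' D" "v \<in> lex_words n m' D"
        and eq: "u(Suc n := m) = v(Suc n := m)"
      show "u = v"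
      proof
        fix i
        show "u i = v i"
        proof (cases "i = Suc n")
          case True
          then show ?thesis using uv by (auto simp: lex_words_def PiE_iff extensional_def)
        next
          case False
          then show ?thesis using fun_cong[OF eq, of i] by simp
        qed
      qed
    qed
    have "card (lex_words n m' D) = (n + m - card D') choose n"
    proof (cases "n \<in> D'")
      case True
      then have "D' = insert n (D \<inter> {1..<n})" by (auto simp: D'_def)
      then have "card D' = Suc (card (D \<inter> {1..<n}))" by simp
      then show ?thesis using IH[of m'] True by (simp add: m'_def)
    next
      case False
      then have "D' = D \<inter> {1..<n}" by (auto simp: D'_def less_Suc_eq)
      then show ?thesis using IH[of m'] False by (simp add: m'_def)
    qed
    then show ?thesis
      unfolding eq using dj inj by (simp add: card_Un_disjoint card_image)
  qed
  show ?case
  proof (induction m)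
    case 0
    have "lex_words (Suc n) 0 D = {}" by (auto simp: lex_words_def PiE_iff)
    then show ?case using D'_n by (simp add: binomial_eq_0)
  next
    case (Suc m)
    have "Suc n + Suc m - 1 - card D' = Suc (n + m - card D')" using D'_n by simp
    moreover have "card (lex_words (Suc n) m D) = (n + m - card D') choose Suc n"
      using Suc by (simp add: D'_def)
    ultimately show ?case using step[of m] unfolding D'_def by simp
  qed
qed

section \<open>Labelled involutions and symmetric multisets\<close>

lemma sorted_enumeration_unique:
  fixes f g :: "nat \<Rightarrow> 'a::linorder"
  assumes "mono_on {1..n} f" "mono_on {1..n} g"
    and "image_mset f (mset_set {1..n}) = image_mset g (mset_set {1..n})"
    and "i \<in> {1..n}"
  shows "f i = g i"
proof -
  define L where "L = [1..<Suc n]"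
  have set: "set L = {1..n}" and distinct: "distinct L" and sorted: "sorted L"
    by (auto simp: L_def simp del: upt_Suc)
  have sorted_map: "sorted (map h L)" if "mono_on {1..n} h" for h :: "nat \<Rightarrow> 'a"
    unfolding sorted_map using that
    by (intro sorted_wrt_mono_rel[OF _ sorted]) (auto simp: set mono_on_def)
  have mset: "mset (map h L) = image_mset h (mset_set {1..n})" for h :: "nat \<Rightarrow> 'a"
    using mset_set_set[OF distinct] by (simp add: set)
  have "sort (map g L) = map f L"
    using assms by (intro properties_for_sort sorted_map) (simp_all only: mset)
  moreover have "sort (map g L) = map g L"
    using assms by (intro properties_for_sort sorted_map refl)
  ultimately have "map f L = map g L" by simp
  then show ?thesis using assms(4) set by (metis map_eq_conv)
qed

lemma sorted_enumeration_exists: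
  fixes M :: "'a::linorder multiset"
  assumes "size M = n"
  obtains f where "mono_on {1..n} f" "image_mset f (mset_set {1..n}) = M"
proof
  define xs where "xs = sorted_list_of_multiset M"
  have M: "mset xs = M" and len: "length xs = n" and sorted: "sorted xs"
    using assms by (auto simp: xs_def simp flip: size_mset)
  show "mono_on {1..n} (\<lambda>i. xs ! (i - 1))"
    using sorted len by (intro mono_onI sorted_nth_mono) auto
  have set: "mset_set {1..n} = image_mset Suc (mset_set {..<n})"
    by (simp add: image_mset_mset_set image_Suc_lessThan)
  have "image_mset (\<lambda>i. xs ! (i - 1)) (mset_set {1..n}) = image_mset ((!) xs) (mset [0..<n])"
    unfolding set by (simp add: multiset.map_comp comp_def atLeast0LessThan)
  also have "\<dots> = M" using M len by (metis map_nth mset_map)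
  finally show "image_mset (\<lambda>i. xs ! (i - 1)) (mset_set {1..n}) = M" .
qed

text \<open>
  A permutation is determined by the relative order of its values.  This turns every uniqueness
  question about permutations below into a comparison of orders.
\<close>

lemma permutation_rank:
  assumes "s permutes {1..n}" "i \<in> {1..n}"
  shows "s i = card {j \<in> {1..n}. s j \<le> s i}"
proof -
  have "s ` {j \<in> {1..n}. s j \<le> s i} = {1..s i}"
  proof (intro equalityI subsetI)
    fix a assume a: "a \<in> {1..s i}"
    have "s i \<le> n" using permutes_in_image[OF assms(1), of i] assms(2) by auto
    then have "a \<in> {1..n}" using a by auto
    then obtain j where "j \<in> {1..n}" "s j = a"
      using permutes_image[OF assms(1)] by (metis imageE)
    then show "a \<in> s ` {j \<in> {1..n}. s j \<le> s i}" using a by auto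
  next
    fix a assume "a \<in> s ` {j \<in> {1..n}. s j \<le> s i}"
    then show "a \<in> {1..s i}"
      using permutes_in_image[OF assms(1)] by (auto simp: Suc_le_eq simp del: One_nat_def)
  qed
  moreover have "inj_on s {j \<in> {1..n}. s j \<le> s i}"
    using permutes_inj[OF assms(1)] by (rule inj_on_subset) simp
  ultimately show ?thesis by (metis card_image card_atLeastAtMost diff_Suc_1)
qed

text \<open>
  The permutation is the rank function of \<open>key\<close>.
\<close>

lemma standardization_exists:
  fixes key :: "nat \<Rightarrow> 'a::linorder"
  assumes "inj_on key {1..n}"
  obtains s where "s permutes {1..n}"
    "\<And>i j. i \<in> {1..n} \<Longrightarrow> j \<in> {1..n} \<Longrightarrow> key i < key j \<Longrightarrow> s i < s j"
proof
  define r where "r i = card {j \<in> {1..n}. key j \<le> key i}" for i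
  define s where "s i = (if i \<in> {1..n} then r i else i)" for i
  have less: "s i < s j" if "i \<in> {1..n}" "j \<in> {1..n}" "key i < key j" for i j
  proof -
    have "{k \<in> {1..n}. key k \<le> key i} \<subset> {k \<in> {1..n}. key k \<le> key j}"
    proof (rule psubsetI)
      show "{k \<in> {1..n}. key k \<le> key i} \<subseteq> {k \<in> {1..n}. key k \<le> key j}"
        using that(3) by auto
      have "j \<in> {k \<in> {1..n}. key k \<le> key j}" "j \<notin> {k \<in> {1..n}. key k \<le> key i}"
        using that by auto
      then show "{k \<in> {1..n}. key k \<le> key i} \<noteq> {k \<in> {1..n}. key k \<le> key j}" by blast
    qed
    then have "r i < r j" unfolding r_def by (intro psubset_card_mono) simp_all
    then show ?thesis using that by (simp add: s_def)
  qed
  then show "\<And>i j. i \<in> {1..n} \<Longrightarrow> j \<in> {1..n} \<Longrightarrow> key i < key j \<Longrightarrow> s i < s j" .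
  have inj: "inj_on s {1..n}"
  proof (rule inj_onI)
    fix i j assume ij: "i \<in> {1..n}" "j \<in> {1..n}" "s i = s j"
    then have "key i = key j"
      using less[of i j] less[of j i] by (cases "key i" "key j" rule: linorder_cases) auto
    then show "i = j" using inj_onD[OF assms] ij by blast
  qed
  have "s ` {1..n} \<subseteq> {1..n}"
  proof
    fix a assume "a \<in> s ` {1..n}"
    then obtain i where i: "i \<in> {1..n}" "a = r i" by (auto simp: s_def)
    have "card {i} \<le> r i" unfolding r_def using i(1) by (intro card_mono) auto
    moreover have "r i \<le> card {1..n}" unfolding r_def by (intro card_mono) auto
    ultimately show "a \<in> {1..n}" using i(2) by simp
  qed
  then have "bij_betw s {1..n} {1..n}"
    using inj endo_inj_surj[of "{1..n}" s] by (simp add: bij_betw_def)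
  then show "s permutes {1..n}" by (intro bij_imp_permutes) (auto simp: s_def)
qed

definition descent_set :: "(nat \<Rightarrow> nat) \<Rightarrow> nat set" where
  "descent_set s = {i. s i > s (i + 1)}"

lemma lex_words_lex_less:
  assumes "s permutes {1..n}" "w \<in> lex_words n m (descent_set s)"
    and "1 \<le> i" "i < j" "j \<le> n"
  shows "(w i, s i) < (w j, s j)"
proof -
  have consecutive: "(w k, s k) < (w (Suc k), s (Suc k))" if "1 \<le> k" "k < n" for k
  proof -
    have "s k \<noteq> s (Suc k)" using permutes_inj[OF assms(1)] by (simp add: inj_eq)
    moreover have "w k \<le> w (k + 1) \<and> (s k > s (k + 1) \<longrightarrow> w k < w (k + 1))"
      using that assms(2) by (simp add: lex_words_def descent_set_def)
    ultimately show ?thesis by auto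
  qed
  have "Suc i \<le> j" using assms by simp
  then show ?thesis using assms(3,5)
  proof (induction j rule: dec_induct)
    case base
    then show ?case using consecutive by simp
  next
    case (step k)
    then have "(w i, s i) < (w k, s k)" "(w k, s k) < (w (Suc k), s (Suc k))"
      using consecutive[of k] by simp_all
    then show ?case by (rule less_trans)
  qed
qed

lemma lex_less_imp_lex_words:
  assumes "w \<in> {1..n} \<rightarrow>\<^sub>E {..<m}"
    and "\<And>i. 1 \<le> i \<Longrightarrow> i < n \<Longrightarrow> (w i, s i) < (w (i + 1), s (i + 1))"
  shows "w \<in> lex_words n m (descent_set s)"
proof -
  have "w i \<le> w (i + 1) \<and> (i \<in> descent_set s \<longrightarrow> w i < w (i + 1))" if "1 \<le> i" "i < n" for i
    using assms(2)[OF that] by (auto simp: descent_set_def)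
  then show ?thesis using assms(1) unfolding lex_words_def by blast
qed

text \<open>
  If \<open>w i = w j\<close> with \<open>i < j\<close>, then \<open>s i < s j\<close>, and monotonicity of \<open>w\<close> applies to the second
  components.  Hence the sequence of pairs can be recovered from its multiset by sorting.
\<close>

lemma lex_words_pairs_mono:
  assumes "s \<in> involutions n" "w \<in> lex_words n m (descent_set s)"
  shows "mono_on {1..n} (\<lambda>i. (w i, w (s i)))"
proof (rule mono_onI)
  fix i j assume ij: "i \<in> {1..n}" "j \<in> {1..n}" "i \<le> j"
  have s: "s permutes {1..n}" using assms by (simp add: involutions_def)
  show "(w i, w (s i)) \<le> (w j, w (s j))"
  proof (cases "i = j")
    case False
    then have "(w i, s i) < (w j, s j)" using lex_words_lex_less[OF s assms(2)] ij by auto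
    moreover have "w (s i) \<le> w (s j)" if "s i < s j"
      using lex_words_mono[OF assms(2), of "s i" "s j"] that ij
        permutes_in_image[OF s, of i] permutes_in_image[OF s, of j] by simp
    ultimately show ?thesis by auto
  qed simp
qed

text \<open>
  If \<open>s a < s b\<close>, the lexicographic condition at the positions \<open>s a\<close> and \<open>s b\<close> compares
  \<open>(w (s a), s (s a))\<close> with \<open>(w (s b), s (s b))\<close>, and \<open>s (s a) = a\<close>, \<open>s (s b) = b\<close>.  So \<open>s\<close> is
  the standardization of the word \<open>w \<circ> s\<close>, and it can be recovered from this word.
\<close>

lemma involution_eq_standardization:
  assumes "s \<in> involutions n" "w \<in> lex_words n m (descent_set s)"
    and "i \<in> {1..n}"
  shows "s i = card {j \<in> {1..n}. (w (s j), j) \<le> (w (s i), i)}"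
proof -
  have s: "s permutes {1..n}" and ss: "s (s k) = k" for k
    using assms(1) by (auto simp: involutions_def fun_eq_iff)
  have lex: "(w (s a), a) < (w (s b), b)"
    if "a \<in> {1..n}" "b \<in> {1..n}" "s a < s b" for a b
    using lex_words_lex_less[OF s assms(2), of "s a" "s b"] that
      permutes_in_image[OF s, of a] permutes_in_image[OF s, of b] by (simp add: ss)
  have "s j \<le> s i \<longleftrightarrow> (w (s j), j) \<le> (w (s i), i)" if "j \<in> {1..n}" for j
  proof (cases "s i" "s j" rule: linorder_cases)
    case less
    with lex[of i j] that assms(3) show ?thesis by auto
  next
    case equal
    then have "i = j" by (metis ss)
    then show ?thesis by simp
  next
    case greater
    with lex[of j i] that assms(3) show ?thesis by auto
  qed
  then have "{j \<in> {1..n}. s j \<le> s i} = {j \<in> {1..n}. (w (s j), j) \<le> (w (s i), i)}" by auto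
  then show ?thesis using permutation_rank[OF s assms(3)] by simp
qed

text \<open>
  In matrix terms a word \<open>w\<close> cuts \<open>{1..n}\<close> into \<open>m\<close> consecutive, possibly empty blocks, on each
  of which the involution increases.  Cutting the permutation matrix of \<open>s\<close> along the blocks and
  counting the ones in each cell gives a symmetric matrix, which is \<open>label_pairs n (s, w)\<close>.
\<close>

definition labelled_involutions :: "nat \<Rightarrow> nat \<Rightarrow> ((nat \<Rightarrow> nat) \<times> (nat \<Rightarrow> nat)) set" where
  "labelled_involutions m n = (SIGMA s : involutions n. lex_words n m (descent_set s))"

definition label_pairs :: "nat \<Rightarrow> (nat \<Rightarrow> nat) \<times> (nat \<Rightarrow> nat) \<Rightarrow> (nat \<times> nat) multiset" where
  "label_pairs n = (\<lambda>(s, w). image_mset (\<lambda>i. (w i, w (s i))) (mset_set {1..n}))"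

lemma image_mset_permutes:
  assumes "s permutes A"
  shows "image_mset s (mset_set A) = mset_set A"
  using assms by (simp add: image_mset_mset_set permutes_inj_on permutes_image)

lemma label_pairs_in_sym_msets:
  assumes "x \<in> labelled_involutions m n"
  shows "label_pairs n x \<in> sym_msets m n"
proof -
  obtain s w where x: "x = (s, w)" by (cases x)
  have s: "s permutes {1..n}" and w: "w \<in> lex_words n m (descent_set s)"
    and ss: "s (s k) = k" for k
    using assms by (auto simp: x involutions_def labelled_involutions_def fun_eq_iff)
  have wm: "w i < m" if "i \<in> {1..n}" for i
    using w that by (auto simp: lex_words_def PiE_iff)
  then have ws: "w (s i) < m" if "i \<in> {1..n}" for i
    using permutes_in_image[OF s, of i] that by simp
  have "image_mset prod.swap (label_pairs n x)
      = image_mset (\<lambda>i. (w i, w (s i))) (image_mset s (mset_set {1..n}))"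
    by (simp add: x label_pairs_def multiset.map_comp comp_def ss)
  also have "\<dots> = label_pairs n x"
    using s by (simp add: image_mset_permutes x label_pairs_def)
  finally show ?thesis
    using wm ws by (auto simp: sym_msets_def x label_pairs_def)
qed

lemma inj_on_label_pairs: "inj_on (label_pairs n) (labelled_involutions m n)"
proof (rule inj_onI)
  fix x x' assume x: "x \<in> labelled_involutions m n" and x': "x' \<in> labelled_involutions m n"
    and eq: "label_pairs n x = label_pairs n x'"
  obtain s w s' w' where xs: "x = (s, w)" "x' = (s', w')" by (cases x, cases x')
  have s: "s \<in> involutions n" "w \<in> lex_words n m (descent_set s)"
    and s': "s' \<in> involutions n" "w' \<in> lex_words n m (descent_set s')"
    using x x' by (auto simp: xs labelled_involutions_def)
  have "image_mset (\<lambda>i. (w i, w (s i))) (mset_set {1..n})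
      = image_mset (\<lambda>i. (w' i, w' (s' i))) (mset_set {1..n})"
    using eq by (simp add: xs label_pairs_def)
  note pairs = sorted_enumeration_unique[OF lex_words_pairs_mono[OF s] lex_words_pairs_mono[OF s'] this]
  have w: "w i = w' i" and ws: "w (s i) = w' (s' i)" if "i \<in> {1..n}" for i
    using pairs[OF that] by blast+
  have "w \<in> {1..n} \<rightarrow>\<^sub>E {..<m}" "w' \<in> {1..n} \<rightarrow>\<^sub>E {..<m}"
    using s(2) s'(2) by (simp_all add: lex_words_def)
  then have "w = w'" using w by (rule PiE_ext)
  moreover have "s = s'"
  proof
    fix i
    show "s i = s' i"
    proof (cases "i \<in> {1..n}")
      case True
      have "s i = card {j \<in> {1..n}. (w (s j), j) \<le> (w (s i), i)}"
        by (rule involution_eq_standardization[OF s True])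
      also have "{j \<in> {1..n}. (w (s j), j) \<le> (w (s i), i)}
          = {j \<in> {1..n}. (w' (s' j), j) \<le> (w' (s' i), i)}"
        using True by (intro Collect_cong conj_cong refl) (simp add: ws)
      also have "card \<dots> = s' i"
        by (rule involution_eq_standardization[OF s' True, symmetric])
      finally show ?thesis .
    next
      case False
      have "s permutes {1..n}" "s' permutes {1..n}"
        using s(1) s'(1) by (simp_all add: involutions_def)
      then show ?thesis using False by (simp add: permutes_not_in)
    qed
  qed
  ultimately show "x = x'" by (simp add: xs)
qed

text \<open>
  Sort the pairs of \<open>M\<close> and let \<open>w\<close> and \<open>v\<close> be the first and the second components.  The
  standardization \<open>s\<close> of \<open>v\<close> moves the swapped pairs into lexicographic order.  As \<open>M\<close> is
  symmetric, the sorted sequence of swapped pairs is the original sequence, so \<open>s\<close> exchanges the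
  roles of \<open>w\<close> and \<open>v\<close>.  This makes \<open>s \<circ> s\<close> order preserving, hence the identity.
\<close>

lemma sym_msets_subset_label_pairs:
  "sym_msets m n \<subseteq> label_pairs n ` labelled_involutions m n"
proof
  fix M assume M: "M \<in> sym_msets m n"
  have "size M = n" using M by (simp add: sym_msets_def)
  then obtain p where p: "mono_on {1..n} p" "image_mset p (mset_set {1..n}) = M"
    by (rule sorted_enumeration_exists)
  define w v where "w = fst \<circ> p" and "v = snd \<circ> p"
  have pwv: "p i = (w i, v i)" for i by (simp add: w_def v_def)
  obtain s where s: "s permutes {1..n}" and
    less: "\<And>i j. i \<in> {1..n} \<Longrightarrow> j \<in> {1..n} \<Longrightarrow> (v i, i) < (v j, j) \<Longrightarrow> s i < s j"
    by (rule standardization_exists[of "\<lambda>i. (v i, i)" n]) (auto simp: inj_on_def)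
  have s_in: "s i \<in> {1..n} \<longleftrightarrow> i \<in> {1..n}" for i using permutes_in_image[OF s] .
  have less_iff: "s i < s j \<longleftrightarrow> (v i, i) < (v j, j)" if "i \<in> {1..n}" "j \<in> {1..n}" for i j
  proof
    assume *: "s i < s j"
    show "(v i, i) < (v j, j)"
    proof (rule ccontr)
      assume "\<not> ?thesis"
      then have "(v j, j) < (v i, i) \<or> i = j" by auto
      then show False using less[OF that(2,1)] * by auto
    qed
  qed (use less that in blast)
  have p_mono: "w i < w j \<or> w i = w j \<and> v i \<le> v j"
    if "i \<in> {1..n}" "j \<in> {1..n}" "i \<le> j" for i j
    using mono_onD[OF p(1) that] by (auto simp: pwv)
  \<comment> \<open>The swapped pairs, arranged along \<open>s\<close>; they turn out to be sorted.\<close>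
  define q where "q = prod.swap \<circ> p \<circ> inv s"
  have qs: "q (s i) = prod.swap (p i)" for i
    using permutes_inverses[OF s] by (simp add: q_def)
  have "mono_on {1..n} q"
  proof (rule mono_onI)
    fix a b assume ab: "a \<in> {1..n}" "b \<in> {1..n}" "a \<le> b"
    define i j where "i = inv s a" and "j = inv s b"
    have ij: "a = s i" "b = s j"
      unfolding i_def j_def by (rule permutes_inverses(1)[OF s, symmetric])+
    have mem: "i \<in> {1..n}" "j \<in> {1..n}" using ab(1,2) unfolding ij s_in .
    show "q a \<le> q b"
    proof (cases "a = b")
      case False
      then have "(v i, i) < (v j, j)" using ab ij less_iff[OF mem] by simp
      then have "(v i, w i) \<le> (v j, w j)" using p_mono[OF mem] by auto
      then show ?thesis by (simp add: ij qs pwv)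
    qed simp
  qed
  moreover have "image_mset q (mset_set {1..n}) = M"
  proof -
    have "image_mset q (mset_set {1..n}) = image_mset q (image_mset s (mset_set {1..n}))"
      using s by (simp add: image_mset_permutes)
    also have "\<dots> = image_mset prod.swap (image_mset p (mset_set {1..n}))"
      by (simp add: multiset.map_comp comp_def qs)
    also have "\<dots> = M" unfolding p(2) using M by (simp add: sym_msets_def)
    finally show ?thesis .
  qed
  ultimately have qp: "q i = p i" if "i \<in> {1..n}" for i
    using sorted_enumeration_unique[of n q p i] p that by simp
  have ws: "w (s i) = v i" and vs: "v (s i) = w i" if "i \<in> {1..n}" for i
    using qp[of "s i"] s_in[of i] that by (simp_all add: qs pwv)
  \<comment> \<open>If \<open>w i = w j\<close>, then \<open>v i \<le> v j\<close>, and the index breaks ties in the order defining \<open>s\<close>.\<close>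
  have lex: "(w i, s i) < (w j, s j)" if "i \<in> {1..n}" "j \<in> {1..n}" "i < j" for i j
    using p_mono[OF that(1,2)] less_iff[OF that(1,2)] that(3) by auto
  have ss_less: "s (s i) < s (s j)" if "i \<in> {1..n}" "j \<in> {1..n}" "i < j" for i j
    using lex[OF that] less_iff[of "s i" "s j"] that(1,2) s_in[of i] s_in[of j] by (simp add: vs)
  have "s (s i) = i" for i
  proof (cases "i \<in> {1..n}")
    case True
    have "s (s j) \<le> s (s i) \<longleftrightarrow> j \<le> i" if "j \<in> {1..n}" for j
      using ss_less[of i j] ss_less[of j i] that True
      by (cases i j rule: linorder_cases) (auto simp: not_le)
    then have "{j \<in> {1..n}. (s \<circ> s) j \<le> (s \<circ> s) i} = {1..i}" using True by auto
    then have "(s \<circ> s) i = card {1..i}"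
      by (rule subst[where P = "\<lambda>S. (s \<circ> s) i = card S"])
        (rule permutation_rank[OF permutes_compose[OF s s] True])
    then show ?thesis by simp
  qed (use permutes_not_in[OF s] in simp)
  then have inv: "s \<in> involutions n" using s by (auto simp: involutions_def)
  define w' where "w' = restrict w {1..n}"
  have w_lt: "w i < m" if "i \<in> {1..n}" for i
  proof -
    have "p i \<in># M" unfolding p(2)[symmetric] using that by simp
    then show ?thesis using M by (auto simp: sym_msets_def pwv)
  qed
  have "w' \<in> lex_words n m (descent_set s)"
  proof (rule lex_less_imp_lex_words)
    show "w' \<in> {1..n} \<rightarrow>\<^sub>E {..<m}" using w_lt by (auto simp: w'_def)
    fix i assume "1 \<le> i" "i < n"
    then show "(w' i, s i) < (w' (i + 1), s (i + 1))" using lex[of i "i + 1"] by (simp add: w'_def)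
  qed
  then have "(s, w') \<in> labelled_involutions m n" using inv by (simp add: labelled_involutions_def)
  moreover have "label_pairs n (s, w') = M"
  proof -
    have "image_mset (\<lambda>i. (w' i, w' (s i))) (mset_set {1..n}) = image_mset p (mset_set {1..n})"
    proof (rule image_mset_cong)
      fix i assume "i \<in># mset_set {1..n}"
      then have i: "i \<in> {1..n}" by simp
      then show "(w' i, w' (s i)) = p i"
        using s_in[of i] ws[OF i] by (simp add: w'_def pwv)
    qed
    then show ?thesis unfolding label_pairs_def p(2) by simp
  qed
  ultimately show "M \<in> label_pairs n ` labelled_involutions m n" by blast
qed

lemma finite_involutions [simp]: "finite (involutions n)"
proof -
  have "finite {s. s permutes {1..n}}" by (intro finite_permutations) simp
  then show ?thesis unfolding involutions_def by simp
qed

lemma card_descent_set: "card (descent_set s \<inter> {1..<n}) = descents n s"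
  unfolding descents_def descent_set_def by (rule arg_cong[where f = card]) auto

text \<open>
  Coefficientwise this is the generating function identity that expresses
  \<open>\<Sum>\<^sub>n I\<^sub>n(t) u\<^sup>n / (1 - t)\<^sup>n\<^sup>+\<^sup>1\<close> through symmetric matrices.
\<close>

lemma card_sym_msets_eq_sum:
  "card (sym_msets m n) = (\<Sum>s\<in>involutions n. (n + m - 1 - descents n s) choose n)"
proof -
  have "sym_msets m n = label_pairs n ` labelled_involutions m n"
    using sym_msets_subset_label_pairs label_pairs_in_sym_msets by blast
  then have "card (sym_msets m n) = card (labelled_involutions m n)"
    by (simp add: card_image inj_on_label_pairs)
  also have "\<dots> = (\<Sum>s\<in>involutions n. card (lex_words n m (descent_set s)))"
    unfolding labelled_involutions_def by (subst card_SigmaI) auto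
  finally show ?thesis unfolding card_lex_words card_descent_set .
qed

section \<open>The recurrence for the descent numbers of involutions\<close>

text \<open>
  The index is an integer so that shifted indices below \<open>0\<close> give the value \<open>0\<close>; this keeps the
  recurrence and the reflection of the index free of case distinctions.
\<close>

definition inv_count :: "nat \<Rightarrow> int \<Rightarrow> int" where
  "inv_count n k = int (card {s \<in> involutions n. int (descents n s) = k})"

lemma descents_le: "descents n s \<le> n - 1"
proof -
  have "descents n s \<le> card {1..<n}" unfolding descents_def by (intro card_mono) auto
  then show ?thesis by simp
qed

lemma inv_count_neg: "k < 0 \<Longrightarrow> inv_count n k = 0"
  by (auto simp: inv_count_def)

lemma inv_count_large:
  assumes "int n < k"
  shows "inv_count n k = 0"
proof -
  have "{s \<in> involutions n. int (descents n s) = k} = {}"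
  proof -
    have "int (descents n s) < k" for s using descents_le[of n s] assms by linarith
    then show ?thesis by fastforce
  qed
  then show ?thesis by (simp add: inv_count_def)
qed

lemma inv_count_le_1:
  assumes "n \<le> 1"
  shows "inv_count n k = (if k = 0 then 1 else 0)"
proof -
  have "involutions n = {id}"
  proof -
    have "s = id" if "s permutes {1..n}" for s
      using that permutes_sing[of s 1] assms by (cases n) auto
    then show ?thesis by (auto simp: involutions_def)
  qed
  moreover have "descents n id = 0" using descents_le[of n id] assms by simp
  ultimately have "{s \<in> involutions n. int (descents n s) = k} = (if k = 0 then {id} else {})"
    by auto
  then show ?thesis by (simp add: inv_count_def)
qed

lemma card_sym_msets_eq_inv_count:
  "int (card (sym_msets m n))
    = (\<Sum>k\<le>n. inv_count n (int k) * int ((n + m - 1 - k) choose n))"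
proof -
  have "descents n ` involutions n \<subseteq> {..n}"     by (auto intro: le_trans[OF descents_le])
  from sum_fun_comp[OF finite_involutions finite_atMost this,
      of "\<lambda>k. int ((n + m - 1 - k) choose n)"]
  show ?thesis
    unfolding card_sym_msets_eq_sum of_nat_sum by (simp add: inv_count_def)
qed

text \<open>
  The coefficient of \<open>f k\<close> in the equation for \<open>m = k + 1\<close> is \<open>1\<close>, and the coefficients of all
  later values vanish in it.
\<close>

lemma binomial_unitriangular:
  fixes f :: "nat \<Rightarrow> int"
  assumes "\<And>m. 1 \<le> m \<Longrightarrow> (\<Sum>k\<le>p. f k * int ((p + m - 1 - k) choose p)) = 0"
    and "k \<le> p"
  shows "f k = 0"
  using assms(2)
proof (induction k rule: less_induct)
  case (less k)
  have "(\<Sum>j\<le>p. f j * int ((p + Suc k - 1 - j) choose p))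
      = (\<Sum>j\<in>{k}. f j * int ((p + Suc k - 1 - j) choose p))"
  proof (rule sum.mono_neutral_right)
    show "\<forall>j\<in>{..p} - {k}. f j * int ((p + Suc k - 1 - j) choose p) = 0"
    proof
      fix j assume j: "j \<in> {..p} - {k}"
      show "f j * int ((p + Suc k - 1 - j) choose p) = 0"
      proof (cases "j < k")
        case True
        then show ?thesis using less by simp
      next
        case False
        then have "p + Suc k - 1 - j < p" using j by auto
        then show ?thesis by (simp add: binomial_eq_0)
      qed
    qed
  qed (use less.prems in auto)
  then show ?case using assms(1)[of "Suc k"] by simp
qed

lemma binomial_lower_step:
  "int (Suc j) * int (x choose Suc j) = (int x - int j) * int (x choose j)"
proof (cases "j \<le> x")
  case True
  have "Suc j * (x choose Suc j) = (x - j) * (x choose j)"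
    by (simp only: binomial_absorption binomial_absorb_comp)
  then have "int (Suc j * (x choose Suc j)) = int ((x - j) * (x choose j))" by simp
  then show ?thesis using True by (simp only: of_nat_mult of_nat_diff)
qed (simp add: binomial_eq_0)

text \<open>
  The two identities convert multiplication by \<open>m\<close> and by \<open>m\<^sup>2 + n\<close>, as it occurs in the recurrence
  for symmetric multisets, into a combination of the binomial coefficients that belong to size
  \<open>n + 2\<close>.  The coefficients in this combination are those of the recurrence for \<open>inv_count\<close>.
  Here \<open>m\<close> is \<open>x + k - n\<close> in the first and \<open>y + k + 1 - n\<close> in the second identity.
\<close>

lemma binomial_identity_1:
  fixes k :: int
  shows "(k + 1) * int (Suc x choose (n + 2)) + (int n + 1 - k) * int (x choose (n + 2))
    = (int x + k - int n) * int (x choose (n + 1))"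
proof -
  have "int (Suc x choose (n + 2)) = int (x choose (n + 2)) + int (x choose (n + 1))" by simp
  moreover have "(int n + 2) * int (x choose (n + 2)) = (int x - int n - 1) * int (x choose (n + 1))"
    using binomial_lower_step[of "n + 1" x] by (simp add: algebra_simps)
  ultimately show ?thesis by algebra
qed

lemma binomial_identity_2:
  fixes k :: int
  shows "((k + 1)\<^sup>2 + int n) * int ((y + 2) choose (n + 2))
      + (2 * (k + 1) * (int n - k) - int n + 1) * int ((y + 1) choose (n + 2))
      + ((int n - k)\<^sup>2 + int n) * int (y choose (n + 2))
    = ((int y + k + 1 - int n)\<^sup>2 + int n) * int (y choose n)"
proof -
  have "int ((y + 2) choose (n + 2))
      = int (y choose (n + 2)) + 2 * int (y choose (n + 1)) + int (y choose n)"
    by (simp add: numeral_2_eq_2)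
  moreover have "int ((y + 1) choose (n + 2)) = int (y choose (n + 2)) + int (y choose (n + 1))"
    by simp
  moreover have "(int n + 2) * int (y choose (n + 2)) = (int y - int n - 1) * int (y choose (n + 1))"
    using binomial_lower_step[of "n + 1" y] by (simp add: algebra_simps)
  moreover have "(int n + 1) * int (y choose (n + 1)) = (int y - int n) * int (y choose n)"
    using binomial_lower_step[of n y] by (simp add: algebra_simps)
  ultimately show ?thesis by algebra
qed

lemma sum_shift_1:
  fixes g :: "int \<Rightarrow> int"
  assumes "g (- 1) = 0"
  shows "(\<Sum>k\<le>Suc K. g (int k - 1) * h k) = (\<Sum>k\<le>K. g (int k) * h (Suc k))"
  by (subst sum.atMost_Suc_shift) (simp add: assms)

definition inv_count_rhs :: "nat \<Rightarrow> int \<Rightarrow> int" where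
  "inv_count_rhs n k =
    (k + 1) * inv_count (n + 1) k + (int n + 2 - k) * inv_count (n + 1) (k - 1)
    + ((k + 1)\<^sup>2 + int n) * inv_count n k
    + (2 * k * (int n + 1 - k) - int n + 1) * inv_count n (k - 1)
    + ((int n + 2 - k)\<^sup>2 + int n) * inv_count n (k - 2)"

text \<open>
  After shifting the index, every summand collects all terms in which one fixed value of
  \<open>inv_count\<close> occurs.  The binomial identities then produce the expansions of the numbers of
  symmetric multisets of sizes \<open>n + 1\<close> and \<open>n\<close>, and these combine to the one of size \<open>n + 2\<close>.
\<close>

lemma sum_inv_count_rhs:
  assumes "1 \<le> m"
  shows "(\<Sum>k\<le>n + 2. inv_count_rhs n (int k) * int ((n + 2 + m - 1 - k) choose (n + 2)))
    = (int n + 2) * int (card (sym_msets m (n + 2)))"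
proof -
  define a where "a = inv_count (n + 1)"
  define b where "b = inv_count n"
  define B where "B k = int ((n + 2 + m - 1 - k) choose (n + 2))" for k
  have a_neg: "a k = 0" and b_neg: "b k = 0" if "k < 0" for k
    using that by (simp_all add: a_def b_def inv_count_neg)
  have a_large: "a k = 0" if "int n + 1 < k" for k
    using that by (simp add: a_def inv_count_large)
  have b_large: "b k = 0" if "int n < k" for k
    using that by (simp add: b_def inv_count_large)
  have "(\<Sum>k\<le>n + 2. (int k + 1) * a (int k) * B k) = (\<Sum>k\<le>n + 1. (int k + 1) * a (int k) * B k)"
    by (intro sum.mono_neutral_right) (auto simp: a_large)
  moreover have "(\<Sum>k\<le>n + 2. (int n + 2 - int k) * a (int k - 1) * B k)
      = (\<Sum>k\<le>n + 1. (int n + 1 - int k) * a (int k) * B (Suc k))"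
    using sum_shift_1[where g = "\<lambda>k. (int n + 1 - k) * a k" and K = "n + 1" and h = B]
    by (simp add: a_neg algebra_simps del: sum.atMost_Suc)
  moreover have "(\<Sum>k\<le>n + 2. ((int k + 1)\<^sup>2 + int n) * b (int k) * B k)
      = (\<Sum>k\<le>n. ((int k + 1)\<^sup>2 + int n) * b (int k) * B k)"
    by (intro sum.mono_neutral_right) (auto simp: b_large)
  moreover have "(\<Sum>k\<le>n + 2. (2 * int k * (int n + 1 - int k) - int n + 1) * b (int k - 1) * B k)
      = (\<Sum>k\<le>n. (2 * (int k + 1) * (int n - int k) - int n + 1) * b (int k) * B (Suc k))"
  proof -
    have "(\<Sum>k\<le>Suc (n + 1). (2 * int k * (int n + 1 - int k) - int n + 1) * b (int k - 1) * B k)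
        = (\<Sum>k\<le>n + 1. (2 * (int k + 1) * (int n - int k) - int n + 1) * b (int k) * B (Suc k))"
      using sum_shift_1[where g = "\<lambda>k. (2 * (k + 1) * (int n - k) - int n + 1) * b k" and K = "n + 1" and h = B]
      by (simp add: b_neg algebra_simps del: sum.atMost_Suc)
    also have "\<dots> = (\<Sum>k\<le>n. (2 * (int k + 1) * (int n - int k) - int n + 1) * b (int k) * B (Suc k))"
      by (simp add: b_large)
    finally show ?thesis by simp
  qed
  moreover have "(\<Sum>k\<le>n + 2. ((int n + 2 - int k)\<^sup>2 + int n) * b (int k - 2) * B k)
      = (\<Sum>k\<le>n. ((int n - int k)\<^sup>2 + int n) * b (int k) * B (Suc (Suc k)))"
  proof -
    have "(\<Sum>k\<le>Suc (Suc n). ((int n + 2 - int k)\<^sup>2 + int n) * b (int k - 2) * B k)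
        = (\<Sum>k\<le>Suc n. ((int n + 1 - int k)\<^sup>2 + int n) * b (int k - 1) * B (Suc k))"
      using sum_shift_1[where g = "\<lambda>k. ((int n + 1 - k)\<^sup>2 + int n) * b (k - 1)" and K = "Suc n" and h = B]
      by (simp add: b_neg algebra_simps del: sum.atMost_Suc)
    also have "\<dots> = (\<Sum>k\<le>n. ((int n - int k)\<^sup>2 + int n) * b (int k) * B (Suc (Suc k)))"
      using sum_shift_1[where g = "\<lambda>k. ((int n - k)\<^sup>2 + int n) * b k" and K = n and h = "\<lambda>k. B (Suc k)"]
      by (simp add: b_neg algebra_simps del: sum.atMost_Suc)
    finally show ?thesis by simp
  qed
  ultimately have "(\<Sum>k\<le>n + 2. inv_count_rhs n (int k) * B k)
      = (\<Sum>k\<le>n + 1. a (int k) * ((int k + 1) * B k + (int n + 1 - int k) * B (Suc k)))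
      + (\<Sum>k\<le>n. b (int k) * (((int k + 1)\<^sup>2 + int n) * B k
          + (2 * (int k + 1) * (int n - int k) - int n + 1) * B (Suc k)
          + ((int n - int k)\<^sup>2 + int n) * B (Suc (Suc k))))"
    unfolding inv_count_rhs_def a_def[symmetric] b_def[symmetric]
    by (simp only: distrib_right sum.distrib distrib_left mult.assoc) (simp only: mult.left_commute)
  also have "(\<Sum>k\<le>n + 1. a (int k) * ((int k + 1) * B k + (int n + 1 - int k) * B (Suc k)))
      = (\<Sum>k\<le>n + 1. int m * (a (int k) * int ((n + 1 + m - 1 - k) choose (n + 1))))"
  proof (rule sum.cong)
    fix k assume k: "k \<in> {..n + 1}"
    define x where "x = n + m - k"
    have x: "n + 2 + m - 1 - k = Suc x" "n + 2 + m - 1 - Suc k = x" "n + 1 + m - 1 - k = x"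
      "int x + int k - int n = int m"
      using k assms by (auto simp: x_def)
    show "a (int k) * ((int k + 1) * B k + (int n + 1 - int k) * B (Suc k))
      = int m * (a (int k) * int ((n + 1 + m - 1 - k) choose (n + 1)))"
      unfolding B_def x binomial_identity_1 by simp
  qed simp
  also have "\<dots> = int m * int (card (sym_msets m (n + 1)))"
    unfolding card_sym_msets_eq_inv_count a_def by (rule sum_distrib_left[symmetric])
  also have "(\<Sum>k\<le>n. b (int k) * (((int k + 1)\<^sup>2 + int n) * B k
          + (2 * (int k + 1) * (int n - int k) - int n + 1) * B (Suc k)
          + ((int n - int k)\<^sup>2 + int n) * B (Suc (Suc k))))
      = (\<Sum>k\<le>n. ((int m)\<^sup>2 + int n) * (b (int k) * int ((n + m - 1 - k) choose n)))"
  proof (rule sum.cong)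
    fix k assume k: "k \<in> {..n}"
    define y where "y = n + m - 1 - k"
    have y: "n + 2 + m - 1 - k = y + 2" "n + 2 + m - 1 - Suc k = y + 1"
      "n + 2 + m - 1 - Suc (Suc k) = y" "n + m - 1 - k = y"
      "int y + int k + 1 - int n = int m"
      using k assms by (auto simp: y_def)
    show "b (int k) * (((int k + 1)\<^sup>2 + int n) * B k
          + (2 * (int k + 1) * (int n - int k) - int n + 1) * B (Suc k)
          + ((int n - int k)\<^sup>2 + int n) * B (Suc (Suc k)))
      = ((int m)\<^sup>2 + int n) * (b (int k) * int ((n + m - 1 - k) choose n))"
      unfolding B_def y binomial_identity_2 by simp
  qed simp
  also have "\<dots> = ((int m)\<^sup>2 + int n) * int (card (sym_msets m n))"
    unfolding card_sym_msets_eq_inv_count b_def by (rule sum_distrib_left[symmetric])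
  also have "int m * int (card (sym_msets m (n + 1))) + ((int m)\<^sup>2 + int n) * int (card (sym_msets m n))
      = int ((n + 2) * card (sym_msets m (n + 2)))"
    unfolding card_sym_msets_rec by simp
  also have "\<dots> = (int n + 2) * int (card (sym_msets m (n + 2)))"
    by (simp only: of_nat_mult of_nat_add of_nat_numeral)
  finally show ?thesis unfolding B_def .
qed

text \<open>
  Both sides have the same expansion in binomial coefficients for every \<open>m\<close>, and such an expansion
  is unique.
\<close>

lemma inv_count_rec:
  "(int n + 2) * inv_count (n + 2) k =
    (k + 1) * inv_count (n + 1) k + (int n + 2 - k) * inv_count (n + 1) (k - 1)
    + ((k + 1)\<^sup>2 + int n) * inv_count n k
    + (2 * k * (int n + 1 - k) - int n + 1) * inv_count n (k - 1)
    + ((int n + 2 - k)\<^sup>2 + int n) * inv_count n (k - 2)"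
proof -
  consider "k < 0" | "k > int n + 2" | "0 \<le> k" "k \<le> int n + 2" by linarith
  then have "(int n + 2) * inv_count (n + 2) k = inv_count_rhs n k"
  proof cases
    case 1
    then show ?thesis by (simp add: inv_count_rhs_def inv_count_neg)
  next
    case 2
    then show ?thesis by (simp add: inv_count_rhs_def inv_count_large)
  next
    case 3
    define f where "f j = inv_count_rhs n (int j) - (int n + 2) * inv_count (n + 2) (int j)" for j
    have "(\<Sum>j\<le>n + 2. f j * int ((n + 2 + m - 1 - j) choose (n + 2))) = 0" if "1 \<le> m" for m
    proof -
      have "(\<Sum>j\<le>n + 2. f j * int ((n + 2 + m - 1 - j) choose (n + 2)))
          = (\<Sum>j\<le>n + 2. inv_count_rhs n (int j) * int ((n + 2 + m - 1 - j) choose (n + 2)))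
          - (int n + 2) * (\<Sum>j\<le>n + 2. inv_count (n + 2) (int j) * int ((n + 2 + m - 1 - j) choose (n + 2)))"
        unfolding f_def left_diff_distrib sum_subtractf sum_distrib_left mult.assoc ..
      then show ?thesis
        unfolding sum_inv_count_rhs[OF that] card_sym_msets_eq_inv_count[symmetric] by simp
    qed
    from binomial_unitriangular[OF this, of "nat k"] 3 show ?thesis by (simp add: f_def)
  qed
  then show ?thesis by (simp add: inv_count_rhs_def)
qed

section \<open>Symmetry and unimodality\<close>

lemma inv_count_2: "inv_count 2 k = (if k = 0 \<or> k = 1 then 1 else 0)"
proof -
  have "2 * inv_count 2 k = (if k = 0 \<or> k = 1 then 2 else 0)"
    using inv_count_rec[of 0 k]
    by (auto simp: inv_count_le_1 simp del: add_2_eq_Suc' One_nat_def split: if_splits)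
  then show ?thesis by (auto split: if_splits)
qed

text \<open>
  The recurrence is invariant under \<open>k \<mapsto> n + 1 - k\<close>: this reflection exchanges the two terms of
  size \<open>n + 1\<close>, exchanges the outer terms of size \<open>n\<close>, and fixes the middle one.
\<close>

lemma inv_count_symmetric:
  assumes "1 \<le> n"
  shows "inv_count n (int n - 1 - k) = inv_count n k"
  using assms
proof (induction n arbitrary: k rule: less_induct)
  case (less N)
  consider "N = 1" | "N = 2" | n where "N = n + 2" "1 \<le> n"
    using less.prems by atomize_elim presburger
  then show ?case
  proof cases
    case 1
    then show ?thesis by (simp add: inv_count_le_1)
  next
    case 2
    then show ?thesis by (auto simp: inv_count_2)
  next
    case (3 n)
    have a: "inv_count (n + 1) (int n - j) = inv_count (n + 1) j" for j
      using less.IH[of "n + 1" j] 3 by simp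
    have b: "inv_count n (int n - 1 - j) = inv_count n j" for j
      using less.IH[of n j] 3 by simp
    have "(int n + 2) * inv_count (n + 2) (int n + 1 - k) = (int n + 2) * inv_count (n + 2) k"
      unfolding inv_count_rec[of n k] inv_count_rec[of n "int n + 1 - k"]
      using a[of k] a[of "k - 1"] b[of k] b[of "k - 1"] b[of "k - 2"]
      by (simp add: algebra_simps)
    then have "inv_count (n + 2) (int n + 1 - k) = inv_count (n + 2) k"
      by (subst (asm) mult_left_cancel) auto
    moreover have "int N - 1 - k = int n + 1 - k" using 3 by simp
    ultimately show ?thesis using 3 by (simp only:)
  qed
qed

definition inv_diff :: "nat \<Rightarrow> int \<Rightarrow> int" where
  "inv_diff n k = inv_count n k - inv_count n (k - 1)"

lemma inv_diff_neg: "k < 0 \<Longrightarrow> inv_diff n k = 0"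
  by (simp add: inv_diff_def inv_count_neg)

lemma inv_diff_antisymmetric:
  assumes "1 \<le> n"
  shows "inv_diff n (int n - k) = - inv_diff n k"
  using inv_count_symmetric[OF assms, of k] inv_count_symmetric[OF assms, of "k - 1"]
  by (simp add: inv_diff_def algebra_simps)

text \<open>
  The coefficients of the recurrence for each of the sizes \<open>n + 1\<close> and \<open>n\<close> have a sum that does not
  depend on \<open>k\<close>.  For this reason the difference of two consecutive instances is a combination of
  differences.
\<close>

lemma inv_diff_rec:
  "(int n + 2) * inv_diff (n + 2) k =
    (k + 1) * inv_diff (n + 1) k + (int n + 3 - k) * inv_diff (n + 1) (k - 1)
    + ((k + 1)\<^sup>2 + int n) * inv_diff n k
    + (2 * k * (int n + 2 - k) - int n + 2) * inv_diff n (k - 1)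
    + ((int n + 3 - k)\<^sup>2 + int n) * inv_diff n (k - 2)"
  unfolding inv_diff_def right_diff_distrib[of "int n + 2"] inv_count_rec
  by (simp add: algebra_simps power2_eq_square)

text \<open>
  The induction step applies the recurrence to size \<open>n + 2\<close>.
  Up to the middle all coefficients in the recurrence for differences are nonnegative wherever the
  difference next to them does not vanish, and a difference of size \<open>n + 1\<close> contributes strictly.
  At the middle of one of the two smaller sizes the difference vanishes by antisymmetry.

  The remaining case is \<open>2 * k = n + 1\<close>, in which \<open>k\<close> lies just beyond the middle of size \<open>n\<close> and
  \<open>inv_diff n k\<close> is \<open>- inv_diff n (k - 1)\<close>.  There the two terms add up to
  \<open>(k - 1) * (k - 3) * inv_diff n (k - 1)\<close>, which is negative only for \<open>k = 2\<close>, \<open>n = 3\<close>, and then it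
  is outweighed by the last term of the recurrence.
\<close>

lemma inv_diff_pos:
  assumes "0 \<le> k" "2 * k < int n"
  shows "0 < inv_diff n k"
  using assms
proof (induction n arbitrary: k rule: less_induct)
  case (less N)
  consider "N = 1" | "N = 2" | n where "N = n + 2" "1 \<le> n"
    using less.prems by atomize_elim presburger
  then show ?case
  proof cases
    case 1
    then show ?thesis using less.prems by (simp add: inv_diff_def inv_count_le_1)
  next
    case 2
    then show ?thesis using less.prems by (simp add: inv_diff_def inv_count_2)
  next
    case (3 n)
    note k = less.prems[unfolded \<open>N = n + 2\<close>]
    define a where "a = inv_diff (n + 1)"
    define b where "b = inv_diff n"
    have a_pos: "0 < a j" if "0 \<le> j" "2 * j < int n + 1" for j
      using less.IH[of "n + 1" j] that 3 by (simp add: a_def)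
    have b_pos: "0 < b j" if "0 \<le> j" "2 * j < int n" for j
      using less.IH[of n j] that 3 by (simp add: b_def)
    have a_anti: "a (int n + 1 - j) = - a j" for j
      using inv_diff_antisymmetric[of "n + 1" j] by (simp add: a_def algebra_simps)
    have b_anti: "b (int n - j) = - b j" for j
      using inv_diff_antisymmetric[of n j] 3 by (simp add: b_def)
    have a_neg: "a j = 0" and b_neg: "b j = 0" if "j < 0" for j
      using that by (simp_all add: a_def b_def inv_diff_neg)
    have a_nonneg: "0 \<le> a j" if "2 * j \<le> int n + 1" for j
    proof -
      consider "j < 0" | "0 \<le> j" "2 * j < int n + 1" | "int n + 1 - j = j" using \<open>2 * j \<le> int n + 1\<close> by linarith
      then show ?thesis using a_neg[of j] a_pos[of j] a_anti[of j] by cases auto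
    qed
    have b_nonneg: "0 \<le> b j" if "2 * j \<le> int n" for j
    proof -
      consider "j < 0" | "0 \<le> j" "2 * j < int n" | "int n - j = j" using \<open>2 * j \<le> int n\<close> by linarith
      then show ?thesis using b_neg[of j] b_pos[of j] b_anti[of j] by cases auto
    qed
    have a_part: "0 < (k + 1) * a k + (int n + 3 - k) * a (k - 1)"
    proof (cases "k = 0")
      case True
      then show ?thesis using a_pos[of 0] a_neg[of "-1"] by simp
    next
      case False
      have "0 \<le> (k + 1) * a k" using a_nonneg[of k] k by simp
      moreover have "0 < (int n + 3 - k) * a (k - 1)" using a_pos[of "k - 1"] k False by simp
      ultimately show ?thesis by linarith
    qed
    have b_last: "0 \<le> ((int n + 3 - k)\<^sup>2 + int n) * b (k - 2)"
      using b_nonneg[of "k - 2"] k by simp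
    have "0 < (int n + 2) * inv_diff (n + 2) k"
    proof (cases "2 * k \<le> int n")
      case True
      have "0 \<le> ((k + 1)\<^sup>2 + int n) * b k" using b_nonneg[OF True] by simp
      moreover have "0 \<le> (2 * k * (int n + 2 - k) - int n + 2) * b (k - 1)"
      proof (cases "k = 0")
        case False
        have "0 \<le> (k - 1) * (int n + 1 - k)" using True False k by simp
        then have "int n + 1 \<le> k * (int n + 2 - k)" by (simp add: algebra_simps)
        then have "0 \<le> 2 * k * (int n + 2 - k) - int n + 2" by simp
        then show ?thesis using b_nonneg[of "k - 1"] True by simp
      qed (simp add: b_neg)
      ultimately show ?thesis
        unfolding inv_diff_rec a_def[symmetric] b_def[symmetric] using a_part b_last by linarith
    next
      case False
      then have n: "int n = 2 * k - 1" using k by linarith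
      have k1: "1 \<le> k" using n 3(2) by linarith
      have bk: "b k = - b (k - 1)" using b_anti[of "k - 1"] n by (simp add: algebra_simps)
      have mid: "((k + 1)\<^sup>2 + int n) * b k + (2 * k * (int n + 2 - k) - int n + 2) * b (k - 1)
          = (k - 1) * (k - 3) * b (k - 1)"
        unfolding bk n by (simp add: algebra_simps power2_eq_square)
      show ?thesis
      proof (cases "k = 2")
        case False
        have "0 \<le> (k - 1) * (k - 3)"
        proof (cases "k = 1")
          case False
          then show ?thesis using k1 \<open>k \<noteq> 2\<close> by simp
        qed simp
        then have "0 \<le> (k - 1) * (k - 3) * b (k - 1)" using b_nonneg[of "k - 1"] n by simp
        then show ?thesis
          unfolding inv_diff_rec a_def[symmetric] b_def[symmetric] using a_part b_last mid by linarith
      next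
        case True
        \<comment> \<open>The sum of the terms at \<open>k\<close> and \<open>k - 1\<close> is \<open>- b 1 = - 1\<close>, the last term is \<open>19 * b 0 = 19\<close>.\<close>
        have n3: "n = 3" using n True by simp
        have "3 * inv_count 3 j = (if j = 0 then 3 else if j = 1 then 6 else if j = 2 then 3 else 0)" for j
          using inv_count_rec[of 1 j]
          by (auto simp: inv_count_le_1 inv_count_2 simp del: add_2_eq_Suc' One_nat_def)
        from this[of 0] this[of 1] this[of "-1"] have "b 0 = 1" "b 1 = 1"
          by (simp_all add: b_def n3 inv_diff_def)
        then show ?thesis
          unfolding inv_diff_rec a_def[symmetric] b_def[symmetric] using a_part mid True n3 by simp
      qed
    qed
    then have "0 < inv_diff (n + 2) k" by (simp only: zero_less_mult_iff) auto
    then show ?thesis using 3 by simp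
  qed
qed

lemma coeff_inv_descent_poly: "coeff (inv_descent_poly n) k = inv_count n (int k)"
proof -
  have "coeff (inv_descent_poly n) k = (\<Sum>s\<in>involutions n. if descents n s = k then 1 else 0)"
    by (simp add: inv_descent_poly_def coeff_sum)
  also have "\<dots> = int (card {s \<in> involutions n. descents n s = k})"
    by (simp add: sum.If_cases Collect_conj_eq)
  finally show ?thesis by (simp add: inv_count_def)
qed

theorem theorem2p7:
  fixes n k :: nat
  assumes "n \<ge> 1"
    and "1 \<le> k"
    and "real k \<le> 0.175 * real n powr 0.931"
  shows "coeff (inv_descent_poly n) (k - 1) < coeff (inv_descent_poly n) k
    \<and> coeff (inv_descent_poly n) (n - 1 - k) > coeff (inv_descent_poly n) (n - k)"
proof -
  \<comment> \<open>The bound puts \<open>k\<close> below the middle of the coefficient sequence.\<close>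
  have "real n powr 0.931 \<le> real n powr 1" using assms(1) by (intro powr_mono) auto
  then have "real k \<le> 0.175 * real n" using assms(1,3) by simp
  then have "2 * real k < real n" using assms(1) by simp
  then have "2 * k < n" by linarith
  then have less: "inv_count n (int k - 1) < inv_count n (int k)"
    using inv_diff_pos[of "int k" n] by (simp add: inv_diff_def)
  have "int (n - 1 - k) = int n - 1 - int k" "int (n - k) = int n - 1 - (int k - 1)"
    "int (k - 1) = int k - 1"
    using \<open>2 * k < n\<close> assms(2) by auto
  with less show ?thesis
    unfolding coeff_inv_descent_poly by (simp only: inv_count_symmetric[OF assms(1)])
qed

end
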